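(* The system $$ \begin{cases} {}_{0}D^{\alpha}_{t}y(x,t) = \mathcal{A}y(x,t) + \mathcal{B}u(t) & \text{in } Q,\\ y(\xi,t)=0 & \text{on } \Sigma,\\ \lim_{t\to 0^{+}}{}_{0}I^{1-\alpha}_{t}y(x,t)=y_{0}(x) & \text{in } \Omega, \end{cases} $$ is exact enlarged controllable relatively to $G$ in $\omega$ (that is, for every $y_0\in Y$ there exists $u\in L^2(0,T;\mathbb{R}^m)$ with $\chi_\omega y(\cdot,T;u)\in G$) if and only if, for every $y_0\in Y$, $$ \bigl(G-\{\chi_{\omega}T^{\alpha-1}K_{\alpha}(T)y_{0}\}\bigr)\cap \operatorname{Im}(\chi_{\omega}H)\neq\emptyset . $$
   Context: Let $\Omega\subset\mathbb{R}^n$ ($n=1,2,3$) be open and bounded with regular boundary, $T>0$, $Q=\Omega\times[0,T]$, $\Sigma=\partial\Omega\times[0,T]$, $0<\alpha<1$, and $Y=L^2(\Omega)$. The Riemann–Liouville integral and derivative in time are ${}_0I_t^{1-\alpha}y(x,t)=\frac{1}{\Gamma(1-\alpha)}\int_0^t(t-s)^{-\alpha}y(x,s)\,ds$ and ${}_0D_t^\alpha y=\frac{\partial}{\partial t}\,{}_0I_t^{1-\alpha}y$. The operator $\mathcal{A}$ is a densely defined linear second-order differential operator with coefficients independent of $t$ (with the zero Dirichlet boundary condition) generating a $C_0$-semigroup $(S(t))_{t\ge0}$ on $Y$. The control operator is a linear operator $\mathcal{B}:\mathbb{R}^m\to Y$, where $m$ is the number of actuators; controls are $u\in L^2(0,T;\mathbb{R}^m)$.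 Let $$\varphi_\alpha(\theta)=\frac1\pi\sum_{n=1}^\infty(-1)^{n-1}\theta^{-\alpha n-1}\frac{\Gamma(n\alpha+1)}{n!}\sin(n\pi\alpha),\qquad \phi_\alpha(\theta)=\frac1\alpha\theta^{-1-1/\alpha}\varphi_\alpha(\theta^{-1/\alpha}),\quad \theta>0,$$ and $K_\alpha(t)=\alpha\int_0^\infty\theta\,\phi_\alpha(\theta)S(t^\alpha\theta)\,d\theta$. Solutions are mild solutions: the solution at time $T$ with control $u$ is $y(\cdot,T;u)=T^{\alpha-1}K_\alpha(T)y_0+Hu$, where $H:L^2(0,T;\mathbb{R}^m)\to Y$ is the operator $$Hu=\int_0^T(T-s)^{\alpha-1}K_\alpha(T-s)\mathcal{B}u(s)\,ds,$$ which is assumed to be well defined on $L^2(0,T;\mathbb{R}^m)$. Let $\omega\subset\Omega$ be a region of positive Lebesgue measure and $\chi_\omega:L^2(\Omega)\to L^2(\omega)$, $\chi_\omega y=y|_\omega$, the restriction operator. $G$ is a closed vector subspace of $L^2(\omega)$. For a set $G$ and an element $a$, $G-\{a\}=\{g-a: g\in G\}$. *)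

theory Defs
  imports "HOL-Analysis.Analysis"
begin

section \<open>The Hilbert space of square-integrable functions\<close>

definition square_integrable :: "('a::euclidean_space \<Rightarrow> 'b::euclidean_space) \<Rightarrow> bool" where
  "square_integrable f \<longleftrightarrow>
     f \<in> borel_measurable lebesgue \<and> integrable lebesgue (\<lambda>x. (norm (f x))\<^sup>2)"

definition ae_eq_l2 ::
  "('a::euclidean_space \<Rightarrow> 'b::euclidean_space) \<Rightarrow> ('a \<Rightarrow> 'b) \<Rightarrow> bool" where
  "ae_eq_l2 f g \<longleftrightarrow>
     square_integrable f \<and> square_integrable g \<and> (AE x in lebesgue. f x = g x)"

lemma square_integrable_zero: "square_integrable (\<lambda>x. 0)"
  by (simp add: square_integrable_def)

lemma square_integrable_dominated:
  assumes "square_integrable f" "g \<in> borel_measurable lebesgue"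
    and "AE x in lebesgue. norm (g x) \<le> norm (f x)"
  shows "square_integrable g"
  unfolding square_integrable_def
proof
  show "integrable lebesgue (\<lambda>x. (norm (g x))\<^sup>2)"
  proof (rule Bochner_Integration.integrable_bound)
    show "integrable lebesgue (\<lambda>x. (norm (f x))\<^sup>2)"
      using assms by (simp add: square_integrable_def)
    show "AE x in lebesgue. norm ((norm (g x))\<^sup>2) \<le> norm ((norm (f x))\<^sup>2)"
      using assms(3) by eventually_elim (simp add: power_mono)
  qed (use assms in measurable)
qed fact

lemma norm_add_squared_le: "(norm (x + y))\<^sup>2 \<le> 2 * (norm x)\<^sup>2 + 2 * (norm (y::'b::real_inner))\<^sup>2"
proof -
  have "0 \<le> (norm (x - y))\<^sup>2" by simp
  then show ?thesis
    by (simp add: power2_norm_eq_inner inner_simps inner_commute)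
qed

lemma square_integrable_add:
  assumes "square_integrable f" "square_integrable g"
  shows "square_integrable (\<lambda>x. f x + g x)"
  unfolding square_integrable_def
proof
  show "integrable lebesgue (\<lambda>x. (norm (f x + g x))\<^sup>2)"
  proof (rule Bochner_Integration.integrable_bound)
    show "integrable lebesgue (\<lambda>x. 2 * (norm (f x))\<^sup>2 + 2 * (norm (g x))\<^sup>2)"
      using assms by (simp add: square_integrable_def)
  qed (use assms in \<open>auto simp: square_integrable_def norm_add_squared_le\<close>)
qed (use assms in \<open>auto simp: square_integrable_def\<close>)

lemma square_integrable_scaleR:
  assumes "square_integrable f" shows "square_integrable (\<lambda>x. c *\<^sub>R f x)"
  using assms by (auto simp: square_integrable_def power_mult_distrib)

lemma square_integrable_uminus:
  assumes "square_integrable f" shows "square_integrable (\<lambda>x. - f x)"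
  using assms by (auto simp: square_integrable_def)

lemma square_integrable_diff:
  assumes "square_integrable f" "square_integrable g"
  shows "square_integrable (\<lambda>x. f x - g x)"
  using square_integrable_add[OF assms(1) square_integrable_uminus[OF assms(2)]] by simp

lemma square_integrable_inner:
  assumes "square_integrable f" "square_integrable g"
  shows "integrable lebesgue (\<lambda>x. f x \<bullet> g x)"
proof (rule Bochner_Integration.integrable_bound)
  show "integrable lebesgue (\<lambda>x. (norm (f x))\<^sup>2 + (norm (g x))\<^sup>2)"
    using assms by (simp add: square_integrable_def)
  show "AE x in lebesgue. norm (f x \<bullet> g x) \<le> norm ((norm (f x))\<^sup>2 + (norm (g x))\<^sup>2)"
  proof (rule AE_I2)
    fix x
    have "\<bar>f x \<bullet> g x\<bar> \<le> norm (f x) * norm (g x)"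
      by (rule Cauchy_Schwarz_ineq2)
    also have "\<dots> \<le> (norm (f x))\<^sup>2 + (norm (g x))\<^sup>2"
      using sum_squares_bound[of "norm (f x)" "norm (g x)"]
        mult_nonneg_nonneg[OF norm_ge_zero[of "f x"] norm_ge_zero[of "g x"]] by linarith
    finally show "norm (f x \<bullet> g x) \<le> norm ((norm (f x))\<^sup>2 + (norm (g x))\<^sup>2)" by simp
  qed
qed (use assms in \<open>auto simp: square_integrable_def\<close>)

quotient_type (overloaded) ('a, 'b) l2 = "'a::euclidean_space \<Rightarrow> 'b::euclidean_space" / partial: ae_eq_l2
proof (rule part_equivpI)
  show "\<exists>f. ae_eq_l2 f (f :: 'a \<Rightarrow> 'b)"
    by (rule exI[of _ "\<lambda>x. 0"]) (simp add: ae_eq_l2_def square_integrable_zero)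
  show "symp (ae_eq_l2 :: ('a \<Rightarrow> 'b) \<Rightarrow> _)"
    by (rule sympI) (auto simp: ae_eq_l2_def)
  show "transp (ae_eq_l2 :: ('a \<Rightarrow> 'b) \<Rightarrow> _)"
    by (rule transpI) (auto simp: ae_eq_l2_def)
qed

instantiation l2 :: (euclidean_space, euclidean_space) real_inner
begin

lift_definition zero_l2 :: "('a, 'b) l2" is "\<lambda>x. 0"
  by (simp add: ae_eq_l2_def square_integrable_zero)

lift_definition plus_l2 :: "('a, 'b) l2 \<Rightarrow> ('a, 'b) l2 \<Rightarrow> ('a, 'b) l2" is "\<lambda>f g x. f x + g x"
  by (auto simp: ae_eq_l2_def square_integrable_add)

lift_definition uminus_l2 :: "('a, 'b) l2 \<Rightarrow> ('a, 'b) l2" is "\<lambda>f x. - f x"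
  by (auto simp: ae_eq_l2_def square_integrable_uminus)

lift_definition minus_l2 :: "('a, 'b) l2 \<Rightarrow> ('a, 'b) l2 \<Rightarrow> ('a, 'b) l2" is "\<lambda>f g x. f x - g x"
  by (auto simp: ae_eq_l2_def square_integrable_diff)

lift_definition scaleR_l2 :: "real \<Rightarrow> ('a, 'b) l2 \<Rightarrow> ('a, 'b) l2" is "\<lambda>c f x. c *\<^sub>R f x"
  by (auto simp: ae_eq_l2_def square_integrable_scaleR)

lift_definition inner_l2 :: "('a, 'b) l2 \<Rightarrow> ('a, 'b) l2 \<Rightarrow> real"
  is "\<lambda>f g. LINT x|lebesgue. f x \<bullet> g x"
  by (rule integral_cong_AE) (auto simp: ae_eq_l2_def square_integrable_def)

definition norm_l2 :: "('a, 'b) l2 \<Rightarrow> real" where "norm_l2 f = sqrt (f \<bullet> f)"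

definition dist_l2 :: "('a, 'b) l2 \<Rightarrow> ('a, 'b) l2 \<Rightarrow> real" where "dist_l2 f g = norm (f - g)"

definition sgn_l2 :: "('a, 'b) l2 \<Rightarrow> ('a, 'b) l2" where "sgn_l2 f = inverse (norm f) *\<^sub>R f"

definition uniformity_l2 :: "(('a, 'b) l2 \<times> ('a, 'b) l2) filter" where
  "uniformity_l2 = (INF e\<in>{0 <..}. principal {(f, g). dist f g < e})"

definition open_l2 :: "('a, 'b) l2 set \<Rightarrow> bool" where
  "open_l2 U \<longleftrightarrow> (\<forall>f\<in>U. \<forall>\<^sub>F (f', g) in uniformity. f' = f \<longrightarrow> g \<in> U)"

instance
proof
  fix f g h :: "('a, 'b) l2" and c d :: real
  show "f + g + h = f + (g + h)"
    by transfer (auto simp: ae_eq_l2_def square_integrable_add add.assoc)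
  show "f + g = g + f"
    by transfer (auto simp: ae_eq_l2_def square_integrable_add add.commute)
  show "0 + f = f"
    by transfer (auto simp: ae_eq_l2_def)
  show "- f + f = 0"
    by transfer (auto simp: ae_eq_l2_def square_integrable_zero)
  show "f - g = f + - g"
    by transfer (auto simp: ae_eq_l2_def square_integrable_diff)
  show "c *\<^sub>R (f + g) = c *\<^sub>R f + c *\<^sub>R g"
    by transfer (auto simp: ae_eq_l2_def scaleR_add_right
        intro!: square_integrable_add square_integrable_scaleR)
  show "(c + d) *\<^sub>R f = c *\<^sub>R f + d *\<^sub>R f"
    by transfer (auto simp: ae_eq_l2_def scaleR_add_left
        intro!: square_integrable_add square_integrable_scaleR)
  show "c *\<^sub>R d *\<^sub>R f = (c * d) *\<^sub>R f"
    by transfer (auto simp: ae_eq_l2_def square_integrable_scaleR)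
  show "1 *\<^sub>R f = f"
    by transfer (auto simp: ae_eq_l2_def)
  show "f \<bullet> g = g \<bullet> f"
    by transfer (simp add: inner_commute)
  show "(f + g) \<bullet> h = f \<bullet> h + g \<bullet> h"
    by transfer (simp add: inner_add_left ae_eq_l2_def square_integrable_inner)
  show "(c *\<^sub>R f) \<bullet> g = c * (f \<bullet> g)"
    by transfer simp
  show "0 \<le> f \<bullet> f"
    by transfer simp
  show "f \<bullet> f = 0 \<longleftrightarrow> f = 0"
  proof transfer
    fix f :: "'a \<Rightarrow> 'b" assume f: "ae_eq_l2 f f"
    have "(LINT x|lebesgue. f x \<bullet> f x) = 0 \<longleftrightarrow> (AE x in lebesgue. f x \<bullet> f x = 0)"
      using f by (intro integral_nonneg_eq_0_iff_AE)
        (auto simp: ae_eq_l2_def square_integrable_inner)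
    then show "(LINT x|lebesgue. f x \<bullet> f x) = 0 \<longleftrightarrow> ae_eq_l2 f (\<lambda>x. 0)"
      using f by (simp add: ae_eq_l2_def square_integrable_zero)
  qed
  show "norm f = sqrt (f \<bullet> f)" by (fact norm_l2_def)
  show "dist f g = norm (f - g)" by (fact dist_l2_def)
  show "sgn f = inverse (norm f) *\<^sub>R f" by (fact sgn_l2_def)
next
  show "(uniformity :: (('a, 'b) l2 \<times> ('a, 'b) l2) filter) =
      (INF e\<in>{0 <..}. principal {(f, g). dist f g < e})"
    by (fact uniformity_l2_def)
  show "open U \<longleftrightarrow> (\<forall>f\<in>U. \<forall>\<^sub>F (f', g) in uniformity. f' = f \<longrightarrow> g \<in> U)" for U :: "('a, 'b) l2 set"
    by (fact open_l2_def)
qed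

end

lemma rep_l2_square_integrable: "square_integrable (rep_l2 f)"
  using Quotient_rep_reflp[OF Quotient_l2, of f] by (simp add: ae_eq_l2_def)

lemma abs_rep_l2: "abs_l2 (rep_l2 f) = f"
  by (rule Quotient_abs_rep[OF Quotient_l2])

lemma abs_l2_eq_iff:
  assumes "square_integrable f" "square_integrable g"
  shows "abs_l2 f = abs_l2 g \<longleftrightarrow> (AE x in lebesgue. f x = g x)"
  using assms Quotient_rel[OF Quotient_l2, of f g] by (auto simp: ae_eq_l2_def)

lemma rep_abs_l2:
  assumes "square_integrable f"
  shows "AE x in lebesgue. rep_l2 (abs_l2 f) x = f x"
  using Quotient_rep_abs[OF Quotient_l2, of f] assms by (auto simp: ae_eq_l2_def)

lemma abs_l2_add:
  "square_integrable f \<Longrightarrow> square_integrable g \<Longrightarrow> abs_l2 (\<lambda>x. f x + g x) = abs_l2 f + abs_l2 g"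
  by (simp add: plus_l2.abs_eq ae_eq_l2_def)

lemma abs_l2_diff:
  "square_integrable f \<Longrightarrow> square_integrable g \<Longrightarrow> abs_l2 (\<lambda>x. f x - g x) = abs_l2 f - abs_l2 g"
  by (simp add: minus_l2.abs_eq ae_eq_l2_def)

lemma abs_l2_scaleR:
  "square_integrable f \<Longrightarrow> abs_l2 (\<lambda>x. c *\<^sub>R f x) = c *\<^sub>R abs_l2 f"
  by (simp add: scaleR_l2.abs_eq ae_eq_l2_def)

lemma norm_abs_l2:
  "square_integrable f \<Longrightarrow> (norm (abs_l2 f))\<^sup>2 = (LINT x|lebesgue. (norm (f x))\<^sup>2)"
  by (simp add: power2_norm_eq_inner inner_l2.abs_eq ae_eq_l2_def)

lemma l2_dominated_convergence:
  fixes f :: "nat \<Rightarrow> 'a::euclidean_space \<Rightarrow> 'b::euclidean_space"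
  assumes f: "\<And>n. square_integrable (f n)" and g: "g \<in> borel_measurable lebesgue"
    and lim: "AE x in lebesgue. (\<lambda>n. f n x) \<longlonglongrightarrow> g x"
    and w: "integrable lebesgue w"
    and bound: "\<And>n. AE x in lebesgue. (norm (f n x - g x))\<^sup>2 \<le> w x"
  shows "square_integrable g" "(\<lambda>n. abs_l2 (f n)) \<longlonglongrightarrow> abs_l2 g"
proof -
  have meas: "f n \<in> borel_measurable lebesgue" for n
    using f by (simp add: square_integrable_def)
  have diff: "square_integrable (\<lambda>x. f n x - g x)" for n
    unfolding square_integrable_def
  proof
    show "integrable lebesgue (\<lambda>x. (norm (f n x - g x))\<^sup>2)"
      using bound[of n] by (intro Bochner_Integration.integrable_bound[OF w])
        (use meas g in \<open>auto elim!: AE_mp\<close>)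
  qed (use meas g in measurable)
  show sg: "square_integrable g"
    using square_integrable_diff[OF f[of 0] diff[of 0]] by simp
  have "(\<lambda>n. LINT x|lebesgue. (norm (f n x - g x))\<^sup>2) \<longlonglongrightarrow> (LINT x|(lebesgue::'a measure). (0::real))"
  proof (rule integral_dominated_convergence[OF _ _ w])
    show "AE x in lebesgue. (\<lambda>n. (norm (f n x - g x))\<^sup>2) \<longlonglongrightarrow> 0"
      using lim
    proof eventually_elim
      case (elim x)
      then have "(\<lambda>n. (norm (f n x - g x))\<^sup>2) \<longlonglongrightarrow> (norm (g x - g x))\<^sup>2"
        by (intro tendsto_intros)
      then show ?case by simp
    qed
  qed (use meas g bound in auto)
  then have "(\<lambda>n. (norm (abs_l2 (f n) - abs_l2 g))\<^sup>2) \<longlonglongrightarrow> 0"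
    by (simp add: norm_abs_l2[symmetric] diff abs_l2_diff f sg)
  then have "(\<lambda>n. norm (abs_l2 (f n) - abs_l2 g)) \<longlonglongrightarrow> 0"
    using tendsto_real_sqrt by fastforce
  then show "(\<lambda>n. abs_l2 (f n)) \<longlonglongrightarrow> abs_l2 g"
    using LIM_zero_cancel tendsto_norm_zero_iff by blast
qed

instance l2 :: (euclidean_space, euclidean_space) banach
proof
  fix X :: "nat \<Rightarrow> ('a, 'b) l2" assume "Cauchy X"
  then have "\<exists>N. \<forall>m\<ge>N. \<forall>n\<ge>N. norm (X m - X n) < (1/4)^k" for k
    by (auto simp: Cauchy_def dist_norm)
  then obtain N where N: "\<And>k m n. m \<ge> N k \<Longrightarrow> n \<ge> N k \<Longrightarrow> norm (X m - X n) < (1/4)^k"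
    by metis
  define r where "r k = Max (N ` {..k})" for k
  have r: "N k \<le> r k" "r k \<le> r (Suc k)" for k
    by (auto simp: r_def intro: Max_mono)
  define Y where "Y k = rep_l2 (X (r k))" for k
  define d where "d k x = Y (Suc k) x - Y k x" for k x
  have sqY: "square_integrable (Y k)" for k
    by (simp add: Y_def rep_l2_square_integrable)
  then have sqd: "square_integrable (d k)" for k
    by (simp add: d_def[abs_def] square_integrable_diff)
  have measY [measurable]: "Y k \<in> borel_measurable lebesgue" for k
    using sqY by (simp add: square_integrable_def)
  have measd [measurable]: "d k \<in> borel_measurable lebesgue" for k
    using sqd by (simp add: square_integrable_def)
  have absY: "abs_l2 (Y k) = X (r k)" for k
    by (simp add: Y_def abs_rep_l2)
  have int_d: "(LINT x|lebesgue. (norm (d k x))\<^sup>2) \<le> (1/16)^k" for k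
  proof -
    have "abs_l2 (d k) = X (r (Suc k)) - X (r k)"
      using abs_l2_diff[OF sqY[of "Suc k"] sqY[of k]] by (simp add: d_def[abs_def] absY)
    then have "norm (abs_l2 (d k)) \<le> (1/4)^k"
      using N[of k "r (Suc k)" "r k"] r[of k] by simp
    then have "(norm (abs_l2 (d k)))\<^sup>2 \<le> ((1/4)^k)\<^sup>2"
      by (rule power_mono) simp
    also have "((1/4)^k)\<^sup>2 = (1/16::real)^k"
      by (simp add: power2_eq_square flip: power_mult_distrib)
    finally show ?thesis by (simp add: norm_abs_l2 sqd)
  qed
  define t where "t k x = 4^k * (norm (d k x))\<^sup>2" for k x
  have t_nonneg: "0 \<le> t k x" for k x by (simp add: t_def)
  have t_int: "integrable lebesgue (t k)" for k
    unfolding t_def using sqd by (simp add: square_integrable_def)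
  have t_le: "(LINT x|lebesgue. t k x) \<le> (1/4)^k" for k
  proof -
    have "(LINT x|lebesgue. t k x) = 4^k * (LINT x|lebesgue. (norm (d k x))\<^sup>2)"
      by (simp add: t_def)
    also have "\<dots> \<le> 4^k * (1/16)^k"
      by (intro mult_left_mono int_d) simp
    also have "\<dots> = (1/4)^k"
      by (simp flip: power_mult_distrib)
    finally show ?thesis .
  qed
  have summ_int: "summable (\<lambda>k. LINT x|lebesgue. norm (t k x))"
  proof (rule summable_comparison_test')
    show "summable (\<lambda>k. (1/4::real)^k)" by (simp add: summable_geometric)
    show "norm (LINT x|lebesgue. norm (t k x)) \<le> (1/4)^k" if "0 \<le> k" for k
      using t_le[of k] by (simp add: t_nonneg)
  qed
  have AE_summ: "AE x in lebesgue. summable (\<lambda>k. t k x)"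
  proof -
    have "(\<integral>\<^sup>+x. (\<Sum>k. ennreal (t k x)) \<partial>lebesgue) = (\<Sum>k. \<integral>\<^sup>+x. ennreal (t k x) \<partial>lebesgue)"
      by (rule nn_integral_suminf) (simp add: t_def)
    also have "\<dots> = (\<Sum>k. ennreal (LINT x|lebesgue. t k x))"
      by (simp add: nn_integral_eq_integral t_int t_nonneg)
    also have "\<dots> \<noteq> \<infinity>"
      using summ_int by (subst suminf_ennreal2) (auto simp: t_nonneg)
    finally have "AE x in lebesgue. (\<Sum>k. ennreal (t k x)) \<noteq> \<infinity>"
      by (intro nn_integral_noteq_infinite) (simp_all add: t_def)
    then show ?thesis
      by eventually_elim (rule summable_suminf_not_top, auto simp: t_nonneg)
  qed
  define w where "w x = (\<Sum>k. t k x)" for x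
  have w_int: "integrable lebesgue w"
    unfolding w_def using AE_summ summ_int
    by (intro integrable_suminf t_int) (auto simp: t_nonneg)
  define g where "g x = lim (\<lambda>n. Y n x)" for x
  have g_meas: "g \<in> borel_measurable lebesgue"
    unfolding g_def by measurable
  have tail: "(\<lambda>n. Y n x) \<longlonglongrightarrow> g x \<and> (\<forall>n. (norm (Y n x - g x))\<^sup>2 \<le> 4 * w x)"
    if summ: "summable (\<lambda>k. t k x)" for x
  proof -
    have w0: "0 \<le> w x"
      unfolding w_def using summ by (intro suminf_nonneg) (auto simp: t_nonneg)
    have nd: "norm (d k x) \<le> sqrt (w x) * (1/2)^k" for k
    proof -
      have "t k x \<le> w x"
        unfolding w_def using sum_le_suminf[OF summ, of "{k}"] by (simp add: t_nonneg)
      then have "(norm (d k x))\<^sup>2 \<le> w x * (1/4)^k"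
        by (simp add: t_def field_simps power_divide)
      also have "(1/4)^k = ((1/2::real)^k)\<^sup>2"
        by (simp add: power2_eq_square flip: power_mult_distrib)
      also have "w x * ((1/2)^k)\<^sup>2 = (sqrt (w x) * (1/2)^k)\<^sup>2"
        using w0 by (simp add: power_mult_distrib)
      finally show ?thesis
        by (rule power2_le_imp_le) (simp add: w0)
    qed
    have geo: "summable (\<lambda>k. sqrt (w x) * (1/2)^k)"
      by (intro summable_mult summable_geometric) simp
    have sd: "summable (\<lambda>k. norm (d k x))"
      by (rule summable_comparison_test'[OF geo, of 0]) (simp add: nd)
    have Yn: "Y n x = Y 0 x + (\<Sum>k<n. d k x)" for n
      by (induction n) (simp_all add: d_def)
    have "(\<lambda>n. Y 0 x + (\<Sum>k<n. d k x)) \<longlonglongrightarrow> Y 0 x + (\<Sum>k. d k x)"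
      using summable_LIMSEQ[OF summable_norm_cancel[OF sd]] by (intro tendsto_intros)
    then have lim: "(\<lambda>n. Y n x) \<longlonglongrightarrow> Y 0 x + (\<Sum>k. d k x)"
      by (simp flip: Yn)
    then have g: "g x = Y 0 x + (\<Sum>k. d k x)"
      unfolding g_def by (rule limI)
    have "(norm (Y n x - g x))\<^sup>2 \<le> 4 * w x" for n
    proof -
      have "g x - Y n x = (\<Sum>k. d (k + n) x)"
        using suminf_minus_initial_segment[OF summable_norm_cancel[OF sd], of n] by (simp add: g Yn[of n])
      then have "norm (Y n x - g x) = norm (\<Sum>k. d (k + n) x)"
        by (metis norm_minus_commute)
      also have "\<dots> \<le> (\<Sum>k. norm (d (k + n) x))"
        using sd by (intro summable_norm) (simp add: summable_iff_shift[of "\<lambda>k. norm (d k x)"])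
      also have "\<dots> \<le> (\<Sum>k. sqrt (w x) * (1/2)^k)"
      proof (rule suminf_le[OF _ _ geo])
        fix k
        have "norm (d (k + n) x) \<le> sqrt (w x) * (1/2)^(k + n)" by (rule nd)
        also have "\<dots> \<le> sqrt (w x) * (1/2)^k"
          by (intro mult_left_mono power_decreasing) (auto simp: w0)
        finally show "norm (d (k + n) x) \<le> sqrt (w x) * (1/2)^k" .
      qed (use sd in \<open>simp add: summable_iff_shift[of "\<lambda>k. norm (d k x)"]\<close>)
      also have "\<dots> = 2 * sqrt (w x)"
        by (subst suminf_mult) (simp_all add: summable_geometric suminf_geometric)
      finally have "(norm (Y n x - g x))\<^sup>2 \<le> (2 * sqrt (w x))\<^sup>2"
        by (rule power_mono) simp
      then show ?thesis using w0 by (simp add: power_mult_distrib)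
    qed
    with lim g show ?thesis by simp
  qed
  have "(\<lambda>n. abs_l2 (Y n)) \<longlonglongrightarrow> abs_l2 g"
  proof (rule l2_dominated_convergence(2))
    show "AE x in lebesgue. (\<lambda>n. Y n x) \<longlonglongrightarrow> g x"
      using AE_summ by eventually_elim (use tail in blast)
    show "integrable lebesgue (\<lambda>x. 4 * w x)" using w_int by simp
    show "AE x in lebesgue. (norm (Y n x - g x))\<^sup>2 \<le> 4 * w x" for n
      using AE_summ by eventually_elim (use tail in blast)
  qed (use sqY g_meas in auto)
  then have lim: "(\<lambda>k. X (r k)) \<longlonglongrightarrow> abs_l2 g"
    by (simp add: absY)
  have "X \<longlonglongrightarrow> abs_l2 g"
  proof (rule LIMSEQ_I)
    fix e :: real assume "0 < e"
    then obtain k1 where k1: "(1/4)^k1 < e/2"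
      using real_arch_pow_inv[of "e/2" "1/4"] by auto
    obtain k2 where k2: "\<And>k. k \<ge> k2 \<Longrightarrow> norm (X (r k) - abs_l2 g) < e/2"
      using LIMSEQ_D[OF lim, of "e/2"] \<open>0 < e\<close> by auto
    define k where "k = max k1 k2"
    have "(1/4::real)^k \<le> (1/4)^k1"
      by (rule power_decreasing) (auto simp: k_def)
    show "\<exists>n0. \<forall>n\<ge>n0. norm (X n - abs_l2 g) < e"
    proof (intro exI allI impI)
      fix n assume n: "N k \<le> n"
      have "norm (X n - abs_l2 g) \<le> norm (X n - X (r k)) + norm (X (r k) - abs_l2 g)"
        using norm_triangle_ineq[of "X n - X (r k)" "X (r k) - abs_l2 g"] by simp
      also have "\<dots> < e"
      proof -
        have "norm (X n - X (r k)) < (1/4)^k" using N n r(1) by blast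
        moreover have "norm (X (r k) - abs_l2 g) < e/2" by (rule k2) (simp add: k_def)
        ultimately show ?thesis using k1 \<open>(1/4::real)^k \<le> (1/4)^k1\<close> by linarith
      qed
      finally show "norm (X n - abs_l2 g) < e" .
    qed
  qed
  then show "convergent X" by (auto simp: convergent_def)
qed

lemma square_integrable_indicator:
  assumes "A \<in> lmeasurable"
  shows "square_integrable (\<lambda>x. indicator A x *\<^sub>R b)"
    and "(LINT x|lebesgue. (norm (indicator A x *\<^sub>R b))\<^sup>2) = measure lebesgue A * (norm b)\<^sup>2"
proof -
  have eq: "(norm (indicator A x *\<^sub>R b))\<^sup>2 = indicator A x * (norm b)\<^sup>2" for x
    by (simp add: indicator_def)
  have "A \<in> sets lebesgue" using assms by blast
  then have [measurable]: "(indicator A :: 'a \<Rightarrow> real) \<in> borel_measurable lebesgue"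
    by simp
  show "square_integrable (\<lambda>x. indicator A x *\<^sub>R b)"
    unfolding square_integrable_def eq using assms by (simp add: lmeasurable_iff_integrable)
  show "(LINT x|lebesgue. (norm (indicator A x *\<^sub>R b))\<^sup>2) = measure lebesgue A * (norm b)\<^sup>2"
    unfolding eq using assms by simp
qed

lemma closure_add_closed:
  fixes D :: "'a::real_normed_vector set"
  assumes D: "\<And>x y. x \<in> D \<Longrightarrow> y \<in> D \<Longrightarrow> x + y \<in> D"
    and "x \<in> closure D" "y \<in> closure D"
  shows "x + y \<in> closure D"
proof -
  obtain u v where "\<And>n. u n \<in> D" "u \<longlonglongrightarrow> x" "\<And>n. v n \<in> D" "v \<longlonglongrightarrow> y"
    using assms(2,3) unfolding closure_sequential by blast
  then show ?thesis
    unfolding closure_sequential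
    by (intro exI[of _ "\<lambda>n. u n + v n"] conjI allI D tendsto_add)
qed

lemma l2_separable:
  "\<exists>D :: ('a::euclidean_space, 'b::euclidean_space) l2 set. countable D \<and> closure D = UNIV"
proof -
  obtain B :: "'a set set" where B: "countable B" "\<And>C. C \<in> B \<Longrightarrow> open C"
    "\<And>S. open S \<Longrightarrow> \<exists>U. U \<subseteq> B \<and> S = \<Union>U"
    using univ_second_countable by blast
  obtain Q :: "'b set" where Q: "countable Q" "\<And>X. open X \<Longrightarrow> X \<noteq> {} \<Longrightarrow> \<exists>q\<in>Q. q \<in> X"
    by (erule countable_dense_setE)
  define \<U> where "\<U> = {U. U \<in> lmeasurable \<and> (\<exists>F. finite F \<and> F \<subseteq> B \<and> U = \<Union>F)}"
  define ind where "ind A b = abs_l2 (\<lambda>x. indicator A x *\<^sub>R b)" for A :: "'a set" and b :: 'b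
  define D where "D = sum_list ` lists ((\<lambda>(U, q). ind U q) ` (\<U> \<times> Q))"
  have "\<U> \<subseteq> Union ` {F. finite F \<and> F \<subseteq> B}" by (auto simp: \<U>_def)
  then have "countable \<U>"
    using countable_Collect_finite_subset[OF B(1)] countable_subset countable_image by metis
  then have countable: "countable D"
    unfolding D_def using Q(1) by (intro countable_image countable_lists countable_SIGMA) auto
  have D_add: "x + y \<in> D" if xy: "x \<in> D" "y \<in> D" for x y
  proof -
    obtain xs ys where "x = sum_list xs" "xs \<in> lists ((\<lambda>(U, q). ind U q) ` (\<U> \<times> Q))"
      "y = sum_list ys" "ys \<in> lists ((\<lambda>(U, q). ind U q) ` (\<U> \<times> Q))"
      using xy unfolding D_def by blast
    then show ?thesis
      unfolding D_def by (intro image_eqI[of _ _ "xs @ ys"]) auto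
  qed
  note add = closure_add_closed[of D, OF D_add]
  have zero: "0 \<in> closure D"
  proof -
    have "0 \<in> D" unfolding D_def by (rule image_eqI[of _ _ "[]"]) auto
    then show ?thesis using closure_subset by blast
  qed
  have closed_lim: "l \<in> closure D" if "\<And>n. u n \<in> closure D" "u \<longlonglongrightarrow> l" for u l
    using that by (meson closed_closure closed_sequentially)
  have indQ: "ind U q \<in> D" if "U \<in> \<U>" "q \<in> Q" for U q
    unfolding D_def by (rule image_eqI[of _ _ "[ind U q]"]) (use that in auto)
  have ind\<U>: "ind U b \<in> closure D" if U: "U \<in> \<U>" for U b
  proof -
    have "\<exists>q\<in>Q. dist b q < inverse (real (Suc n))" for n
      using Q(2)[of "ball b (inverse (real (Suc n)))"] by auto
    then obtain q where q: "\<And>n. q n \<in> Q" "\<And>n. dist b (q n) < inverse (real (Suc n))"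
      by metis
    have Um: "U \<in> lmeasurable" using U by (simp add: \<U>_def)
    have qlim: "q \<longlonglongrightarrow> b"
    proof (rule metric_LIMSEQ_I)
      fix e :: real assume "0 < e"
      then obtain n0 where n0: "inverse (real (Suc n0)) < e" using reals_Archimedean by blast
      show "\<exists>n0. \<forall>n\<ge>n0. dist (q n) b < e"
      proof (intro exI allI impI)
        fix n assume "n0 \<le> n"
        then have "inverse (real (Suc n)) \<le> inverse (real (Suc n0))" by simp
        then show "dist (q n) b < e"
          using q(2)[of n] n0 unfolding dist_commute[of b] by linarith
      qed
    qed
    have "(\<lambda>n. ind U (q n)) \<longlonglongrightarrow> ind U b"
      unfolding ind_def
    proof (rule l2_dominated_convergence(2))
      show "(\<lambda>x. indicator U x *\<^sub>R b) \<in> borel_measurable lebesgue"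
        using square_integrable_indicator(1)[OF Um, of b] by (simp add: square_integrable_def)
      show "AE x in lebesgue. (\<lambda>n. indicator U x *\<^sub>R q n) \<longlonglongrightarrow> indicator U x *\<^sub>R b"
        by (intro AE_I2 tendsto_intros qlim)
      show "integrable lebesgue (indicator U :: 'a \<Rightarrow> real)"
        using Um by (simp add: lmeasurable_iff_integrable)
      show "AE x in lebesgue. (norm (indicator U x *\<^sub>R q n - indicator U x *\<^sub>R b))\<^sup>2 \<le> indicator U x" for n
      proof (rule AE_I2)
        fix x
        have "inverse (real (Suc n)) \<le> 1" by (simp add: inverse_le_1_iff)
        then have "norm (q n - b) \<le> 1" using q(2)[of n] by (simp add: dist_norm norm_minus_commute)
        then have "(norm (q n - b))\<^sup>2 \<le> 1" by (simp add: power_le_one)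
        then show "(norm (indicator U x *\<^sub>R q n - indicator U x *\<^sub>R b))\<^sup>2 \<le> indicator U x"
          by (simp add: indicator_def)
      qed
    qed (rule square_integrable_indicator(1)[OF Um])
    then show ?thesis
      by (rule closed_lim[rotated]) (use indQ[OF U q(1)] closure_subset in blast)
  qed
  have ind_open: "ind U b \<in> closure D" if U: "open U" "U \<in> lmeasurable" for U b
  proof -
    obtain B' where B': "B' \<subseteq> B" "U = \<Union>B'" using B(3)[OF U(1)] by blast
    show ?thesis
    proof (cases "B' = {}")
      case True
      then have "U \<in> \<U>" using B' U by (auto simp: \<U>_def)
      then show ?thesis by (rule ind\<U>)
    next
      case False
      have "countable B'" using B(1) B'(1) countable_subset by blast
      then have range: "range (from_nat_into B') = B'"
        using False by (simp add: range_from_nat_into)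
      define F where "F n = (\<Union>k<n. from_nat_into B' k)" for n :: nat
      have F_sub: "F n \<subseteq> U" for n
        using range B'(2) by (auto simp: F_def)
      have "open (F n)" for n
        unfolding F_def using range B'(1) B(2) by (intro open_UN) blast
      then have Fm: "F n \<in> lmeasurable" for n
        using F_sub[of n] U(2) by (intro fmeasurableI2[OF U(2)]) auto
      have "F n \<in> \<U>" for n
        unfolding \<U>_def using Fm[of n] range B'(1)
        by (auto simp: F_def intro!: exI[of _ "from_nat_into B' ` {..<n}"])
      then have F_ind: "ind (F n) b \<in> closure D" for n by (rule ind\<U>)
      have UF: "U = (\<Union>k. from_nat_into B' k)" using range B'(2) by simp
      have "(\<lambda>n. ind (F n) b) \<longlonglongrightarrow> ind U b"
        unfolding ind_def
      proof (rule l2_dominated_convergence(2))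
        show "(\<lambda>x. indicator U x *\<^sub>R b) \<in> borel_measurable lebesgue"
          using square_integrable_indicator(1)[OF U(2), of b] by (simp add: square_integrable_def)
        show "AE x in lebesgue. (\<lambda>n. indicator (F n) x *\<^sub>R b) \<longlonglongrightarrow> indicator U x *\<^sub>R b"
          unfolding F_def UF by (intro AE_I2 tendsto_intros LIMSEQ_indicator_UN)
        show "integrable lebesgue (\<lambda>x. (norm (indicator U x *\<^sub>R b))\<^sup>2)"
          using square_integrable_indicator(1)[OF U(2), of b] by (simp add: square_integrable_def)
        show "AE x in lebesgue. (norm (indicator (F n) x *\<^sub>R b - indicator U x *\<^sub>R b))\<^sup>2
            \<le> (norm (indicator U x *\<^sub>R b))\<^sup>2" for n
          using F_sub[of n] by (intro AE_I2) (auto simp: indicator_def)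
      qed (rule square_integrable_indicator(1)[OF Fm])
      then show ?thesis
        by (rule closed_lim[rotated]) (rule F_ind)
    qed
  qed
  have ind_meas: "ind A b \<in> closure D" if A: "A \<in> lmeasurable" for A b
  proof -
    have "\<exists>U. open U \<and> A \<subseteq> U \<and> U - A \<in> lmeasurable \<and> emeasure lebesgue (U - A) < ennreal (inverse (real (Suc n)))" for n
    proof -
      have "A \<in> sets lebesgue" using A by blast
      then show ?thesis
        by (rule sets_lebesgue_outer_open[of A "inverse (real (Suc n))"]) auto
    qed
    then obtain U where U: "\<And>n. open (U n)" "\<And>n. A \<subseteq> U n" "\<And>n. U n - A \<in> lmeasurable"
      "\<And>n. emeasure lebesgue (U n - A) < ennreal (inverse (real (Suc n)))"
      by metis
    have Um: "U n \<in> lmeasurable" for n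
    proof -
      have "U n = A \<union> (U n - A)" using U(2) by auto
      then show ?thesis using fmeasurable.Un[OF A U(3)] by metis
    qed
    have "(\<lambda>n. ind (U n) b - ind A b) \<longlonglongrightarrow> 0"
    proof -
      have n2: "(norm (ind (U n) b - ind A b))\<^sup>2 \<le> inverse (real (Suc n)) * (norm b)\<^sup>2" for n
      proof -
        have "(\<lambda>x. indicator (U n) x *\<^sub>R b - indicator A x *\<^sub>R b) = (\<lambda>x. indicator (U n - A) x *\<^sub>R b)"
          using U(2)[of n] by (auto simp: indicator_def fun_eq_iff)
        then have "ind (U n) b - ind A b = abs_l2 (\<lambda>x. indicator (U n - A) x *\<^sub>R b)"
          unfolding ind_def
          by (simp add: square_integrable_indicator Um A flip: abs_l2_diff)
        then have "(norm (ind (U n) b - ind A b))\<^sup>2 = measure lebesgue (U n - A) * (norm b)\<^sup>2"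
          by (simp only: norm_abs_l2[OF square_integrable_indicator(1)[OF U(3)]]
              square_integrable_indicator(2)[OF U(3)])
        moreover have "measure lebesgue (U n - A) \<le> inverse (real (Suc n))"
          using U(4)[of n] emeasure_eq_measure2[OF U(3)[of n]] by (simp add: ennreal_less_iff)
        ultimately show ?thesis by (simp add: mult_right_mono)
      qed
      have "(\<lambda>n. inverse (real (Suc n)) * (norm b)\<^sup>2) \<longlonglongrightarrow> 0 * (norm b)\<^sup>2"
        by (intro tendsto_intros LIMSEQ_inverse_real_of_nat)
      then have "(\<lambda>n. inverse (real (Suc n)) * (norm b)\<^sup>2) \<longlonglongrightarrow> 0"
        by simp
      then have "(\<lambda>n. (norm (ind (U n) b - ind A b))\<^sup>2) \<longlonglongrightarrow> 0"
        by (rule Lim_null_comparison[rotated]) (use n2 in simp)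
      then have "(\<lambda>n. norm (ind (U n) b - ind A b)) \<longlonglongrightarrow> 0"
        using tendsto_real_sqrt by fastforce
      then show ?thesis using tendsto_norm_zero_iff by blast
    qed
    then have "(\<lambda>n. ind (U n) b) \<longlonglongrightarrow> ind A b" by (rule LIM_zero_cancel)
    then show ?thesis
      by (rule closed_lim[rotated]) (rule ind_open[OF U(1) Um])
  qed
  have simple: "abs_l2 s \<in> closure D" if s: "simple_function lebesgue s" "square_integrable s" for s
  proof -
    have fin: "finite (range s)" using simple_functionD(1)[OF s(1)] by simp
    have level: "s -` {y} \<in> lmeasurable" if "y \<noteq> 0" for y
    proof -
      have "s -` {y} \<in> sets lebesgue" using simple_functionD(2)[OF s(1), of "{y}"] by simp
      then have meas: "(indicator (s -` {y}) :: 'a \<Rightarrow> real) \<in> borel_measurable lebesgue" by simp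
      have "integrable lebesgue (indicator (s -` {y}) :: 'a \<Rightarrow> real)"
      proof (rule Bochner_Integration.integrable_bound[OF _ meas])
        show "integrable lebesgue (\<lambda>x. (norm (s x))\<^sup>2 / (norm y)\<^sup>2)"
          using s(2) by (simp add: square_integrable_def)
        show "AE x in lebesgue. norm (indicator (s -` {y}) x :: real) \<le> norm ((norm (s x))\<^sup>2 / (norm y)\<^sup>2)"
          using that by (intro AE_I2) (auto simp: indicator_def)
      qed
      then show ?thesis by (simp add: lmeasurable_iff_integrable)
    qed
    define p where "p y x = indicator (s -` {y}) x *\<^sub>R y" for y x
    have sum_in: "square_integrable (\<lambda>x. \<Sum>y\<in>R. p y x) \<and> abs_l2 (\<lambda>x. \<Sum>y\<in>R. p y x) \<in> closure D"
      if "finite R" "0 \<notin> R" for R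
      using that
    proof (induction R)
      case empty
      then show ?case using zero by (simp add: square_integrable_zero flip: zero_l2.abs_eq)
    next
      case (insert y R)
      then have y: "s -` {y} \<in> lmeasurable" by (intro level) auto
      have "square_integrable (p y)"
        unfolding p_def[abs_def] by (rule square_integrable_indicator(1)[OF y])
      moreover have "abs_l2 (p y) \<in> closure D"
        using ind_meas[OF y, of y] by (simp add: ind_def p_def[abs_def])
      ultimately show ?case
        using insert by (simp add: square_integrable_add abs_l2_add add)
    qed
    have s_eq: "s = (\<lambda>x. \<Sum>y\<in>range s - {0}. p y x)"
    proof
      fix x
      have "(\<Sum>y\<in>range s - {0}. p y x) = (\<Sum>y\<in>range s - {0}. if y = s x then y else 0)"
        by (intro sum.cong) (auto simp: p_def indicator_def)
      also have "\<dots> = s x" using fin by (simp add: sum.delta')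
      finally show "s x = (\<Sum>y\<in>range s - {0}. p y x)" by simp
    qed
    show ?thesis
      by (subst s_eq) (use sum_in[of "range s - {0}"] fin in blast)
  qed
  have "f \<in> closure D" for f
  proof -
    define h where "h = rep_l2 f"
    have sq: "square_integrable h" by (simp add: h_def rep_l2_square_integrable)
    then have hm: "h \<in> borel_measurable lebesgue" by (simp add: square_integrable_def)
    obtain F where F: "\<And>i. simple_function lebesgue (F i)" "\<And>x. (\<lambda>i. F i x) \<longlonglongrightarrow> h x"
      "\<And>i x. dist (F i x) 0 \<le> 2 * dist (h x) 0"
      using borel_measurable_implies_sequence_metric[OF hm, of 0] by auto
    have Fsq: "square_integrable (F i)" for i
    proof (rule square_integrable_dominated)
      show "square_integrable (\<lambda>x. 2 *\<^sub>R h x)" by (rule square_integrable_scaleR[OF sq])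
      show "F i \<in> borel_measurable lebesgue" by (rule borel_measurable_simple_function[OF F(1)])
      show "AE x in lebesgue. norm (F i x) \<le> norm (2 *\<^sub>R h x)" using F(3)[of i] by simp
    qed
    have "(\<lambda>i. abs_l2 (F i)) \<longlonglongrightarrow> abs_l2 h"
    proof (rule l2_dominated_convergence(2)[OF Fsq hm])
      show "integrable lebesgue (\<lambda>x. 9 * (norm (h x))\<^sup>2)"
        using sq by (simp add: square_integrable_def)
      show "AE x in lebesgue. (norm (F n x - h x))\<^sup>2 \<le> 9 * (norm (h x))\<^sup>2" for n
      proof (rule AE_I2)
        fix x
        have "norm (F n x - h x) \<le> 3 * norm (h x)"
          using F(3)[of n x] norm_triangle_ineq4[of "F n x" "h x"] by simp
        then have "(norm (F n x - h x))\<^sup>2 \<le> (3 * norm (h x))\<^sup>2" by (rule power_mono) simp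
        then show "(norm (F n x - h x))\<^sup>2 \<le> 9 * (norm (h x))\<^sup>2" by (simp add: power_mult_distrib)
      qed
    qed (use F(2) in simp)
    then have "abs_l2 h \<in> closure D"
      by (rule closed_lim[rotated]) (rule simple[OF F(1) Fsq])
    then show ?thesis by (simp add: h_def abs_rep_l2)
  qed
  then show ?thesis using countable by blast
qed

instance l2 :: (euclidean_space, euclidean_space) second_countable_topology
proof
  obtain D :: "('a, 'b) l2 set" where D: "countable D" "closure D = UNIV"
    using l2_separable by blast
  define B where "B = (\<lambda>(d, n). ball d (inverse (real (Suc n)))) ` (D \<times> UNIV)"
  have "countable B"
    unfolding B_def using D(1) by (intro countable_image countable_SIGMA) auto
  moreover have "topological_basis B"
  proof (rule topological_basisI)
    fix U :: "('a, 'b) l2 set" and f assume U: "open U" "f \<in> U"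
    then obtain e where e: "0 < e" "ball f e \<subseteq> U" using openE by blast
    obtain n where n: "inverse (real (Suc n)) < e / 2"
      using reals_Archimedean[of "e / 2"] e(1) by auto
    have "f \<in> closure D" using D(2) by simp
    then obtain d where d: "d \<in> D" "dist d f < inverse (real (Suc n))"
      unfolding closure_approachable by (metis inverse_positive_iff_positive of_nat_0_less_iff zero_less_Suc)
    have "ball d (inverse (real (Suc n))) \<subseteq> ball f e"
    proof
      fix g assume "g \<in> ball d (inverse (real (Suc n)))"
      then show "g \<in> ball f e"
        using dist_triangle[of f g d] d(2) n by (simp add: dist_commute)
    qed
    then show "\<exists>V\<in>B. f \<in> V \<and> V \<subseteq> U"
      using d e(2) unfolding B_def by (intro bexI[of _ "ball d (inverse (real (Suc n)))"]) auto
  qed (auto simp: B_def)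
  ultimately show "\<exists>B :: ('a, 'b) l2 set set. countable B \<and> open = generate_topology B"
    by (blast intro: topological_basis_imp_subbasis)
qed

text \<open>
  For a measurable set \<open>X\<close>, the space \<open>L\<^sup>2(X)\<close> is identified, by extension by zero, with the closed
  subspace of functions vanishing almost everywhere outside \<open>X\<close>. Under this identification the
  restriction to \<open>X\<close> is multiplication by the indicator function of \<open>X\<close>.
\<close>

definition L2_on :: "'a::euclidean_space set \<Rightarrow> ('a, 'b::euclidean_space) l2 set" where
  "L2_on X = {f. AE x in lebesgue. x \<notin> X \<longrightarrow> rep_l2 f x = 0}"

definition restrict_l2 ::
  "'a::euclidean_space set \<Rightarrow> ('a, 'b::euclidean_space) l2 \<Rightarrow> ('a, 'b) l2" where
  "restrict_l2 X f = abs_l2 (\<lambda>x. indicator X x *\<^sub>R rep_l2 f x)"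

lemma square_integrable_restrict:
  assumes "X \<in> sets lebesgue" "square_integrable f"
  shows "square_integrable (\<lambda>x. indicator X x *\<^sub>R f x)"
proof (rule square_integrable_dominated[OF assms(2)])
  have "f \<in> borel_measurable lebesgue" "(indicator X :: _ \<Rightarrow> real) \<in> borel_measurable lebesgue"
    using assms by (simp_all add: square_integrable_def)
  then show "(\<lambda>x. indicator X x *\<^sub>R f x) \<in> borel_measurable lebesgue" by simp
qed (simp add: indicator_def)

lemma rep_l2_restrict:
  assumes "X \<in> sets lebesgue"
  shows "AE x in lebesgue. rep_l2 (restrict_l2 X f) x = indicator X x *\<^sub>R rep_l2 f x"
  unfolding restrict_l2_def
  by (rule rep_abs_l2[OF square_integrable_restrict[OF assms rep_l2_square_integrable]])

lemma restrict_l2_in_L2_on: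
  assumes "X \<in> sets lebesgue" shows "restrict_l2 X f \<in> L2_on X"
  unfolding L2_on_def mem_Collect_eq using rep_l2_restrict[OF assms, of f]
  by eventually_elim simp

lemma restrict_l2_abs:
  assumes "X \<in> sets lebesgue" "square_integrable f"
  shows "restrict_l2 X (abs_l2 f) = abs_l2 (\<lambda>x. indicator X x *\<^sub>R f x)"
proof -
  have "AE x in lebesgue. indicator X x *\<^sub>R rep_l2 (abs_l2 f) x = indicator X x *\<^sub>R f x"
    using rep_abs_l2[OF assms(2)] by eventually_elim simp
  then show ?thesis
    unfolding restrict_l2_def
    by (simp add: abs_l2_eq_iff square_integrable_restrict assms rep_l2_square_integrable)
qed

lemma linear_restrict_l2:
  assumes "X \<in> sets lebesgue" shows "linear (restrict_l2 X)"
proof (rule linearI)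
  fix f g :: "('a, 'b) l2" and c :: real
  note sq = rep_l2_square_integrable[of f] rep_l2_square_integrable[of g]
  note sqX = sq[THEN square_integrable_restrict[OF assms]]
  have "restrict_l2 X (f + g) = restrict_l2 X (abs_l2 (\<lambda>x. rep_l2 f x + rep_l2 g x))"
    by (simp add: abs_l2_add sq abs_rep_l2)
  also have "\<dots> = restrict_l2 X f + restrict_l2 X g"
    by (subst restrict_l2_abs[OF assms square_integrable_add[OF sq]])
      (simp add: restrict_l2_def scaleR_add_right abs_l2_add sqX)
  finally show "restrict_l2 X (f + g) = restrict_l2 X f + restrict_l2 X g" .
  have "restrict_l2 X (c *\<^sub>R f) = restrict_l2 X (abs_l2 (\<lambda>x. c *\<^sub>R rep_l2 f x))"
    by (simp add: abs_l2_scaleR sq abs_rep_l2)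
  also have "\<dots> = c *\<^sub>R restrict_l2 X f"
    using abs_l2_scaleR[OF sqX(1), of c]
    by (subst restrict_l2_abs[OF assms square_integrable_scaleR[OF sq(1)]])
      (simp add: restrict_l2_def mult.commute)
  finally show "restrict_l2 X (c *\<^sub>R f) = c *\<^sub>R restrict_l2 X f" .
qed


section \<open>Domains and second-order operators with Dirichlet boundary condition\<close>

text \<open>
  Locally, in the direction \<open>e\<close>, the set lies strictly above the graph of a Lipschitz function of
  the coordinates orthogonal to \<open>e\<close>.
\<close>

definition lipschitz_boundary :: "'a::euclidean_space set \<Rightarrow> bool" where
  "lipschitz_boundary \<Omega> \<longleftrightarrow>
     (\<forall>p\<in>frontier \<Omega>. \<exists>r>0. \<exists>e \<gamma> L. norm e = 1 \<and> L-lipschitz_on UNIV \<gamma> \<and>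
        (\<forall>z t. \<gamma> (z + t *\<^sub>R e) = \<gamma> z) \<and> \<Omega> \<inter> ball p r = {z \<in> ball p r. \<gamma> z < z \<bullet> e})"

primrec k_times_differentiable :: "nat \<Rightarrow> ('a::euclidean_space \<Rightarrow> real) \<Rightarrow> bool" where
  "k_times_differentiable 0 f \<longleftrightarrow> continuous_on UNIV f"
| "k_times_differentiable (Suc k) f \<longleftrightarrow>
     (\<exists>F. (\<forall>x. GDERIV f x :> F x) \<and> (\<forall>i\<in>Basis. k_times_differentiable k (\<lambda>x. F x \<bullet> i)))"

definition test_function :: "'a::euclidean_space set \<Rightarrow> ('a \<Rightarrow> real) \<Rightarrow> bool" where
  "test_function \<Omega> \<psi> \<longleftrightarrow>
     (\<forall>k. k_times_differentiable k \<psi>) \<and> (\<exists>K. compact K \<and> K \<subseteq> \<Omega> \<and> (\<forall>x. x \<notin> K \<longrightarrow> \<psi> x = 0))"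

definition locally_integrable ::
  "'a::euclidean_space set \<Rightarrow> ('a \<Rightarrow> 'b::euclidean_space) \<Rightarrow> bool" where
  "locally_integrable \<Omega> f \<longleftrightarrow> (\<forall>K. compact K \<and> K \<subseteq> \<Omega> \<longrightarrow> set_integrable lebesgue K f)"

definition weak_divergence :: "'a::euclidean_space set \<Rightarrow> ('a \<Rightarrow> 'a) \<Rightarrow> ('a \<Rightarrow> real) \<Rightarrow> bool" where
  "weak_divergence \<Omega> F h \<longleftrightarrow> locally_integrable \<Omega> F \<and> locally_integrable \<Omega> h \<and>
     (\<forall>\<psi> d\<psi>. test_function \<Omega> \<psi> \<longrightarrow> (\<forall>x. GDERIV \<psi> x :> d\<psi> x) \<longrightarrow>
        (LINT x:\<Omega>|lebesgue. F x \<bullet> d\<psi> x) = - (LINT x:\<Omega>|lebesgue. h x * \<psi> x))"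

definition weak_gradient ::
  "(real^'n) set \<Rightarrow> (real^'n \<Rightarrow> real) \<Rightarrow> (real^'n \<Rightarrow> real^'n) \<Rightarrow> bool" where
  "weak_gradient \<Omega> y g \<longleftrightarrow> (\<forall>i. weak_divergence \<Omega> (\<lambda>x. y x *\<^sub>R axis i 1) (\<lambda>x. g x $ i))"

text \<open>\<open>H\<^sub>0\<^sup>1(\<Omega>)\<close>, the closure of the test functions in the norm of \<open>H\<^sup>1(\<Omega>)\<close>.\<close>

definition H10 :: "'a::euclidean_space set \<Rightarrow> ('a, real) l2 set" where
  "H10 \<Omega> = {y. \<exists>g \<psi> d\<psi>. (\<forall>k. test_function \<Omega> (\<psi> k) \<and> (\<forall>x. GDERIV (\<psi> k) x :> d\<psi> k x)) \<and>
      (\<lambda>k. abs_l2 (\<psi> k)) \<longlonglongrightarrow> y \<and> (\<lambda>k. abs_l2 (d\<psi> k)) \<longlonglongrightarrow> g}"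

text \<open>
  \<open>f = \<Sum>\<^sub>i\<^sub>j a\<^sub>i\<^sub>j \<partial>\<^sub>i\<partial>\<^sub>j y + \<Sum>\<^sub>i b\<^sub>i \<partial>\<^sub>i y + c y\<close> and
  \<open>f = \<Sum>\<^sub>i \<partial>\<^sub>i (\<Sum>\<^sub>j a\<^sub>i\<^sub>j \<partial>\<^sub>j y) + \<Sum>\<^sub>i b\<^sub>i \<partial>\<^sub>i y + c y\<close> in \<open>\<Omega>\<close>, with weak derivatives.
\<close>

definition nondivergence_form ::
  "(real^'n) set \<Rightarrow> (real^'n \<Rightarrow> real^'n^'n) \<Rightarrow> (real^'n \<Rightarrow> real^'n) \<Rightarrow> (real^'n \<Rightarrow> real) \<Rightarrow>
    (real^'n \<Rightarrow> real) \<Rightarrow> (real^'n \<Rightarrow> real) \<Rightarrow> bool" where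
  "nondivergence_form \<Omega> a b c y f \<longleftrightarrow>
     (\<exists>g h. weak_gradient \<Omega> y g \<and> (\<forall>i. weak_gradient \<Omega> (\<lambda>x. g x $ i) (\<lambda>x. h x $ i)) \<and>
        (AE x in lebesgue. x \<in> \<Omega> \<longrightarrow>
           f x = (\<Sum>i\<in>UNIV. \<Sum>j\<in>UNIV. a x $ i $ j * h x $ i $ j) + b x \<bullet> g x + c x * y x))"

definition divergence_form ::
  "(real^'n) set \<Rightarrow> (real^'n \<Rightarrow> real^'n^'n) \<Rightarrow> (real^'n \<Rightarrow> real^'n) \<Rightarrow> (real^'n \<Rightarrow> real) \<Rightarrow>
    (real^'n \<Rightarrow> real) \<Rightarrow> (real^'n \<Rightarrow> real) \<Rightarrow> bool" where
  "divergence_form \<Omega> a b c y f \<longleftrightarrow>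
     (\<exists>g. weak_gradient \<Omega> y g \<and>
        weak_divergence \<Omega> (\<lambda>x. a x *v g x) (\<lambda>x. f x - b x \<bullet> g x - c x * y x))"

text \<open>
  The order is exactly two because the symmetric part of the leading coefficient matrix, which is
  the only part seen by second derivatives, does not vanish almost everywhere.
\<close>

definition second_order_differential_operator ::
  "(real^'n) set \<Rightarrow> (real^'n, real) l2 set \<Rightarrow> ((real^'n, real) l2 \<Rightarrow> (real^'n, real) l2) \<Rightarrow> bool"
  where
  "second_order_differential_operator \<Omega> D A \<longleftrightarrow>
     (\<exists>a b c. a \<in> borel_measurable lebesgue \<and> b \<in> borel_measurable lebesgue \<and>
        c \<in> borel_measurable lebesgue \<and>
        \<not> (AE x in lebesgue. x \<in> \<Omega> \<longrightarrow> a x + transpose (a x) = 0) \<and>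
        ((\<forall>y\<in>D. nondivergence_form \<Omega> a b c (rep_l2 y) (rep_l2 (A y))) \<or>
         (\<forall>y\<in>D. divergence_form \<Omega> a b c (rep_l2 y) (rep_l2 (A y)))))"


section \<open>Strongly continuous semigroups\<close>

definition linear_on :: "'a::real_vector set \<Rightarrow> ('a \<Rightarrow> 'b::real_vector) \<Rightarrow> bool" where
  "linear_on V f \<longleftrightarrow> (\<forall>x\<in>V. \<forall>y\<in>V. f (x + y) = f x + f y) \<and> (\<forall>c. \<forall>x\<in>V. f (c *\<^sub>R x) = c *\<^sub>R f x)"

definition C0_semigroup_on ::
  "'a::real_normed_vector set \<Rightarrow> (real \<Rightarrow> 'a \<Rightarrow> 'a) \<Rightarrow> bool" where
  "C0_semigroup_on V S \<longleftrightarrow>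
     (\<forall>t\<ge>0. S t ` V \<subseteq> V \<and> linear_on V (S t) \<and> (\<exists>M. \<forall>y\<in>V. norm (S t y) \<le> M * norm y)) \<and>
     (\<forall>y\<in>V. S 0 y = y) \<and>
     (\<forall>s\<ge>0. \<forall>t\<ge>0. \<forall>y\<in>V. S (s + t) y = S s (S t y)) \<and>
     (\<forall>y\<in>V. ((\<lambda>t. S t y) \<longlongrightarrow> y) (at_right 0))"

definition generates_semigroup_on ::
  "'a::real_normed_vector set \<Rightarrow> 'a set \<Rightarrow> ('a \<Rightarrow> 'a) \<Rightarrow> (real \<Rightarrow> 'a \<Rightarrow> 'a) \<Rightarrow> bool" where
  "generates_semigroup_on V D A S \<longleftrightarrow>
     D = {y \<in> V. \<exists>z. ((\<lambda>t. (S t y - y) /\<^sub>R t) \<longlongrightarrow> z) (at_right 0)} \<and>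
     (\<forall>y\<in>D. ((\<lambda>t. (S t y - y) /\<^sub>R t) \<longlongrightarrow> A y) (at_right 0))"


section \<open>Mild solutions and enlarged controllability\<close>

text \<open>
  \<open>stable_density \<alpha>\<close> is the one-sided stable density, with Laplace transform \<open>exp (- s\<^sup>\<alpha>)\<close>, and
  \<open>phi_density \<alpha>\<close> is the associated Wright-type density. The series, usually indexed from 1, is
  shifted to start at 0.
\<close>

definition stable_density :: "real \<Rightarrow> real \<Rightarrow> real" where
  "stable_density \<alpha> \<theta> = 1 / pi * (\<Sum>n. (-1) ^ n * \<theta> powr (- \<alpha> * real (Suc n) - 1) *
     (Gamma (real (Suc n) * \<alpha> + 1) / fact (Suc n)) * sin (real (Suc n) * pi * \<alpha>))"

definition phi_density :: "real \<Rightarrow> real \<Rightarrow> real" where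
  "phi_density \<alpha> \<theta> = 1 / \<alpha> * \<theta> powr (- 1 - 1 / \<alpha>) * stable_density \<alpha> (\<theta> powr (- 1 / \<alpha>))"

definition K_op ::
  "real \<Rightarrow> (real \<Rightarrow> 'a \<Rightarrow> 'a) \<Rightarrow> real \<Rightarrow> 'a \<Rightarrow> 'a::{banach, second_countable_topology}" where
  "K_op \<alpha> S t y = \<alpha> *\<^sub>R (LINT \<theta>:{0<..}|lebesgue. (\<theta> * phi_density \<alpha> \<theta>) *\<^sub>R S (t powr \<alpha> * \<theta>) y)"

definition control_integrand ::
  "real \<Rightarrow> (real \<Rightarrow> 'a \<Rightarrow> 'a) \<Rightarrow> (real^'m \<Rightarrow> 'a) \<Rightarrow> real \<Rightarrow> (real, real^'m) l2 \<Rightarrow> real \<Rightarrow>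
    'a::{banach, second_countable_topology}" where
  "control_integrand \<alpha> S B t u s = (t - s) powr (\<alpha> - 1) *\<^sub>R K_op \<alpha> S (t - s) (B (rep_l2 u s))"

definition H_op ::
  "real \<Rightarrow> (real \<Rightarrow> 'a \<Rightarrow> 'a) \<Rightarrow> (real^'m \<Rightarrow> 'a) \<Rightarrow> real \<Rightarrow> (real, real^'m) l2 \<Rightarrow>
    'a::{banach, second_countable_topology}" where
  "H_op \<alpha> S B t u = (LINT s:{0..t}|lebesgue. control_integrand \<alpha> S B t u s)"

definition mild_solution ::
  "real \<Rightarrow> (real \<Rightarrow> 'a \<Rightarrow> 'a) \<Rightarrow> (real^'m \<Rightarrow> 'a) \<Rightarrow> 'a \<Rightarrow> (real, real^'m) l2 \<Rightarrow> real \<Rightarrow>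
    'a::{banach, second_countable_topology}" where
  "mild_solution \<alpha> S B y0 u t = t powr (\<alpha> - 1) *\<^sub>R K_op \<alpha> S t y0 + H_op \<alpha> S B t u"

definition exact_enlarged_controllable ::
  "'d::euclidean_space set \<Rightarrow> real \<Rightarrow> real \<Rightarrow> (real \<Rightarrow> ('d, real) l2 \<Rightarrow> ('d, real) l2) \<Rightarrow>
    (real^'m \<Rightarrow> ('d, real) l2) \<Rightarrow> 'd set \<Rightarrow> ('d, real) l2 set \<Rightarrow> bool" where
  "exact_enlarged_controllable \<Omega> T \<alpha> S B \<omega> G \<longleftrightarrow>
     (\<forall>y0\<in>L2_on \<Omega>. \<exists>u\<in>L2_on {0<..<T}. restrict_l2 \<omega> (mild_solution \<alpha> S B y0 u T) \<in> G)"

end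

theory Submission
  imports Defs
begin

text \<open>
  The mild solution at time \<open>T\<close> is the sum of the free evolution
  \<open>T powr (\<alpha> - 1) *\<^sub>R K_op \<alpha> S T y0\<close> and the controlled part \<open>H_op \<alpha> S B T u\<close>, and restriction to
  \<open>\<omega>\<close> is additive. So the restricted solution equals some \<open>g \<in> G\<close> exactly when the restriction of
  \<open>H_op \<alpha> S B T u\<close> equals \<open>g\<close> minus the restricted free evolution, that is, when \<open>u\<close> is sent by
  the restricted control-to-state map into the translate of \<open>G\<close>.
\<close>

theorem theorem2:
  fixes \<Omega> \<omega> :: "(real^'n) set"
    and T \<alpha> :: real
    and D :: "(real^'n, real) l2 set"
    and A :: "(real^'n, real) l2 \<Rightarrow> (real^'n, real) l2"
    and S :: "real \<Rightarrow> (real^'n, real) l2 \<Rightarrow> (real^'n, real) l2"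
    and B :: "real^'m \<Rightarrow> (real^'n, real) l2"
    and G :: "(real^'n, real) l2 set"
  assumes dim: "CARD('n) \<in> {1, 2, 3}"
    and domain: "open \<Omega>" "bounded \<Omega>" "lipschitz_boundary \<Omega>"
    and time: "0 < T"
    and order: "0 < \<alpha>" "\<alpha> < 1"
    and densely_defined: "subspace D" "D \<subseteq> L2_on \<Omega>" "L2_on \<Omega> \<subseteq> closure D"
    and operator: "linear_on D A" "A ` D \<subseteq> L2_on \<Omega>" "second_order_differential_operator \<Omega> D A"
    and dirichlet: "D \<subseteq> H10 \<Omega>"
    and semigroup: "C0_semigroup_on (L2_on \<Omega>) S" "generates_semigroup_on (L2_on \<Omega>) D A S"
    and control: "linear B" "range B \<subseteq> L2_on \<Omega>"
    and H_well_defined: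
      "\<forall>u\<in>L2_on {0<..<T}. set_integrable lebesgue {0..T} (control_integrand \<alpha> S B T u)"
    and region: "\<omega> \<in> sets lebesgue" "\<omega> \<subseteq> \<Omega>" "0 < emeasure lebesgue \<omega>"
    and target: "subspace G" "closed G" "G \<subseteq> L2_on \<omega>"
  shows "exact_enlarged_controllable \<Omega> T \<alpha> S B \<omega> G \<longleftrightarrow>
    (\<forall>y0\<in>L2_on \<Omega>.
      {g - restrict_l2 \<omega> (T powr (\<alpha> - 1) *\<^sub>R K_op \<alpha> S T y0) | g. g \<in> G} \<inter>
      (restrict_l2 \<omega> \<circ> H_op \<alpha> S B T) ` L2_on {0<..<T} \<noteq> {})"
proof -
  have "restrict_l2 \<omega> (mild_solution \<alpha> S B y0 u T) =
      restrict_l2 \<omega> (T powr (\<alpha> - 1) *\<^sub>R K_op \<alpha> S T y0) + restrict_l2 \<omega> (H_op \<alpha> S B T u)"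
    for y0 and u :: "(real, real^'m) l2"
    unfolding mild_solution_def by (rule linear_add[OF linear_restrict_l2[OF region(1)]])
  moreover have "{g - p | g. g \<in> G} \<inter> (restrict_l2 \<omega> \<circ> H_op \<alpha> S B T) ` L2_on {0<..<T} \<noteq> {} \<longleftrightarrow>
      (\<exists>u\<in>L2_on {0<..<T}. p + restrict_l2 \<omega> (H_op \<alpha> S B T u) \<in> G)" for p
  proof -
    have "x \<in> {g - p | g. g \<in> G} \<longleftrightarrow> p + x \<in> G" for x
      by (auto simp: algebra_simps intro!: exI[of _ "p + x"])
    then show ?thesis by auto
  qed
  ultimately show ?thesis
    by (simp only: exact_enlarged_controllable_def)
qed

end
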